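(* For $n\ge 1$ let $$B'(n)=1+(n-1)!+\left(\sum_{d\mid n}\varphi\!\left(\frac nd\right)\frac{n^{d-1}(d-1)!}{d^d}\right)(n-2),$$ where $\varphi$ is Euler's totient function and the sum is over positive divisors $d$ of $n$. Then $$\frac{B'(n)}{(n-1)!}\xrightarrow[n\to\infty]{}2.$$ *)

theory Defs
  imports Complex_Main "HOL-Number_Theory.Totient"
begin

text \<open>The factor \<open>n - 2\<close> is taken in the reals, so it is \<open>-1\<close> at \<open>n = 1\<close>
  (truncated subtraction on \<^typ>\<open>nat\<close> would give \<open>0\<close>). The subtractions
  \<open>n - 1\<close>, \<open>d - 1\<close> and the divisor quotient \<open>n div d\<close> are exact for \<open>n \<ge> 1\<close>;
  the value at \<open>n = 0\<close> is irrelevant.\<close>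

definition B' :: "nat \<Rightarrow> real" where
  "B' n = 1 + fact (n - 1)
     + (\<Sum>d | d dvd n. real (totient (n div d)) * (real n ^ (d - 1) * fact (d - 1) / real d ^ d))
       * (real n - 2)"

end

theory Submission imports Defs "HOL-Real_Asymp.Real_Asymp"
begin

text \<open>The divisor \<open>d = n\<close> contributes \<open>(n - 1)! / n\<close> to the sum. Every other divisor satisfies
  \<open>d \<le> n / 2\<close> and its term is at most \<open>n ^ d\<close>, so together they contribute at most
  \<open>n ^ (n / 2 + 1)\<close>, which is negligible against \<open>(n - 1)!\<close> because \<open>n! \<ge> (n / e) ^ n\<close>.\<close>

text \<open>The left side divided by \<open>fact n\<close> is the term \<open>k = n\<close> of the
  exponential series at \<open>n\<close>, whose terms are all nonnegative. This serves as a weak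
  form of Stirling's lower bound for the factorial.\<close>

lemma power_self_le_exp_mult_fact: "real n ^ n \<le> exp (real n) * fact n"
proof -
  have "(\<Sum>k\<in>{n}. real n ^ k /\<^sub>R fact k) \<le> (\<Sum>k. real n ^ k /\<^sub>R fact k)"
    by (intro sum_le_suminf summable_exp_generic) auto
  also have "\<dots> = exp (real n)"
    by (simp add: exp_def)
  finally show ?thesis by (simp add: field_simps)
qed

text \<open>The totient is at most \<open>n\<close>, which raises \<open>n ^ (d - 1)\<close> to
  \<open>n ^ d\<close>, and the quotient of \<open>fact (d - 1)\<close> by \<open>d ^ d\<close> is
  at most 1.\<close>

lemma divisor_term_le:
  fixes n d :: nat
  assumes "d dvd n" "n > 0"
  shows "real (totient (n div d)) * (real n ^ (d - 1) * fact (d - 1) / real d ^ d) \<le> real n ^ d"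
proof -
  have d: "d > 0" using assms by (auto intro: Nat.gr0I)
  have "(fact (d - 1) :: real) \<le> real ((d - 1) ^ (d - 1))"
    by (rule fact_le_power)
  also have "\<dots> \<le> real d ^ d"
  proof -
    have "(d - 1) ^ (d - 1) \<le> d ^ (d - 1)" by (intro power_mono) auto
    also have "\<dots> \<le> d ^ d" using d by (intro power_increasing) auto
    finally show ?thesis by (simp flip: of_nat_power)
  qed
  finally have *: "fact (d - 1) / real d ^ d \<le> 1"
    using d by simp
  have "totient (n div d) \<le> n"
    using totient_le[of "n div d"] div_le_dividend[of n d] by linarith
  then have "real (totient (n div d)) * (real n ^ (d - 1) * (fact (d - 1) / real d ^ d))
               \<le> real n * (real n ^ (d - 1) * 1)"
    using * by (intro mult_mono) auto
  also have "\<dots> = real n ^ d"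
    using d by (cases d) auto
  finally show ?thesis by simp
qed

text \<open>The factor \<open>real n\<close> bounds the number of proper divisors, the power bounds
  each of their terms.\<close>

lemma proper_divisor_sum_le:
  fixes n :: nat
  assumes "n > 0"
  shows "(\<Sum>d | d dvd n \<and> d \<noteq> n.
           real (totient (n div d)) * (real n ^ (d - 1) * fact (d - 1) / real d ^ d))
         \<le> real n * real n ^ (n div 2)"
proof -
  have sub: "{d. d dvd n \<and> d \<noteq> n} \<subseteq> {1..n}"
    using assms by (auto intro: dvd_imp_le Nat.gr0I simp: Suc_le_eq)
  have "real (totient (n div d)) * (real n ^ (d - 1) * fact (d - 1) / real d ^ d)
          \<le> real n ^ (n div 2)" if "d \<in> {d. d dvd n \<and> d \<noteq> n}" for d
  proof -
    from that obtain k where k: "n = d * k" "k \<noteq> 1" by auto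
    with assms have "k \<ge> 2" by (cases k) auto
    then have "d * 2 \<le> n" unfolding k by (rule mult_le_mono2)
    then have "d \<le> n div 2" by linarith
    then have "real n ^ d \<le> real n ^ (n div 2)"
      using assms by (intro power_increasing) auto
    with divisor_term_le[of d n] that assms show ?thesis by auto
  qed
  then have "(\<Sum>d | d dvd n \<and> d \<noteq> n.
           real (totient (n div d)) * (real n ^ (d - 1) * fact (d - 1) / real d ^ d))
         \<le> real (card {d. d dvd n \<and> d \<noteq> n}) * real n ^ (n div 2)"
    by (rule sum_bounded_above)
  also have "\<dots> \<le> real n * real n ^ (n div 2)"
    using card_mono[OF _ sub] by (intro mult_right_mono) auto
  finally show ?thesis .
qed

theorem theorem7: "(\<lambda>n. B' n / fact (n - 1)) \<longlonglongrightarrow> 2"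
proof -
  define S where "S n = (\<Sum>d | d dvd n \<and> d \<noteq> n.
     real (totient (n div d)) * (real n ^ (d - 1) * fact (d - 1) / real d ^ d))" for n
  define R where "R n = S n * (real n - 2) / fact (n - 1)" for n
  have S_nonneg: "S n \<ge> 0" for n
    unfolding S_def by (intro sum_nonneg) auto
  \<comment> \<open>The term for \<open>d = n\<close> is \<open>fact (n - 1) / n\<close>, since the
    totient of 1 is 1. Multiplied by \<open>n - 2\<close> and divided by
    \<open>fact (n - 1)\<close>, it leaves \<open>(n - 2) / n\<close>.\<close>
  have split: "B' n / fact (n - 1) = 1 / fact (n - 1) + 1 + (real n - 2) / real n + R n"
    if n: "n > 0" for n
  proof -
    have "{d. d dvd n} = insert n {d. d dvd n \<and> d \<noteq> n}" by auto
    moreover have "finite {d. d dvd n \<and> d \<noteq> n}"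
      by (rule finite_subset[OF _ finite_divisors_nat[OF n]]) auto
    moreover have "real n ^ (n - 1) / real n ^ n = 1 / real n"
      using n by (cases n) auto
    ultimately have "(\<Sum>d | d dvd n.
        real (totient (n div d)) * (real n ^ (d - 1) * fact (d - 1) / real d ^ d))
        = fact (n - 1) / real n + S n"
      using n by (simp add: S_def field_simps)
    then show ?thesis
      by (simp add: B'_def R_def add_divide_distrib distrib_right)
  qed
  \<comment> \<open>From \<open>n = 2\<close> on the factor \<open>real n - 2\<close> is
    nonnegative, so an upper bound for \<open>S n\<close> carries over to the product.\<close>
  have R_le: "R n \<le> real n powr (3 - real n / 2) * exp (real n)" if n: "n \<ge> 2" for n
  proof -
    have "S n * (real n - 2) \<le> (real n * real n ^ (n div 2)) * real n"
      using proper_divisor_sum_le[of n] S_nonneg n by (intro mult_mono) (auto simp: S_def)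
    then have "R n \<le> (real n * real n ^ (n div 2)) * real n / fact (n - 1)"
      unfolding R_def by (rule divide_right_mono) simp
    \<comment> \<open>The third factor \<open>n\<close> comes from
      \<open>fact (n - 1) = fact n / n\<close>.\<close>
    also have "\<dots> = real n ^ 3 * real n ^ (n div 2) / fact n"
      using n by (subst (2) fact_reduce) (auto simp: power3_eq_cube)
    \<comment> \<open>A real exponent removes the rounding in \<open>n div 2\<close>, so that the
      final bound is a smooth expression in \<open>n\<close>.\<close>
    also have "real n ^ (n div 2) \<le> real n powr (real n / 2)"
      using n by (subst powr_realpow[symmetric]) (auto intro!: powr_mono)
    then have "real n ^ 3 * real n ^ (n div 2) / fact n
                 \<le> real n ^ 3 * real n powr (real n / 2) / fact n"
      by (intro divide_right_mono mult_left_mono) auto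
    also have "\<dots> \<le> real n ^ 3 * real n powr (real n / 2) * (exp (real n) / real n ^ n)"
    proof -
      have "1 / fact n \<le> exp (real n) / real n ^ n"
        using power_self_le_exp_mult_fact[of n] n by (simp add: field_simps)
      then have "real n ^ 3 * real n powr (real n / 2) * (1 / fact n) \<le>
          real n ^ 3 * real n powr (real n / 2) * (exp (real n) / real n ^ n)"
        by (intro mult_left_mono) auto
      then show ?thesis by simp
    qed
    also have "\<dots> = real n powr (3 + real n / 2 - real n) * exp (real n)"
    proof -
      have "real n powr (3 + real n / 2 - real n)
              = real n powr 3 * real n powr (real n / 2) / real n powr real n"
        by (simp only: powr_diff powr_add)
      then show ?thesis
        using n by (simp add: powr_realpow)
    qed
    also have "3 + real n / 2 - real n = 3 - real n / 2" by simp
    finally show ?thesis .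
  qed
  have "R \<longlonglongrightarrow> 0"
  proof (rule tendsto_sandwich)
    show "\<forall>\<^sub>F n in sequentially. 0 \<le> R n"
      using eventually_ge_at_top[of 2]
      by eventually_elim (auto simp: R_def intro!: divide_nonneg_pos mult_nonneg_nonneg S_nonneg)
    show "\<forall>\<^sub>F n in sequentially. R n \<le> real n powr (3 - real n / 2) * exp (real n)"
      using eventually_ge_at_top[of 2] by eventually_elim (rule R_le)
    \<comment> \<open>The logarithm of the bound is \<open>(3 - n / 2) * ln n + n\<close>, in which
      \<open>- (n / 2) * ln n\<close> dominates.\<close>
    show "(\<lambda>n. real n powr (3 - real n / 2) * exp (real n)) \<longlonglongrightarrow> 0"
      by real_asymp
  qed simp
  moreover have "(\<lambda>n. 1 / fact (n - 1) :: real) \<longlonglongrightarrow> 0"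
  \<comment> \<open>After the index shift the sequence is \<open>1 / fact n\<close>, the terms of
    the convergent series for \<open>exp 1\<close>.\<close>
  proof (subst filterlim_sequentially_Suc[symmetric])
    show "(\<lambda>n. 1 / fact (Suc n - 1) :: real) \<longlonglongrightarrow> 0"
      using summable_LIMSEQ_zero[OF summable_exp[of "1 :: real"]] by (simp add: field_simps)
  qed
  moreover have "(\<lambda>n. (real n - 2) / real n) \<longlonglongrightarrow> 1"
    by real_asymp
  \<comment> \<open>One unit of the limit comes from the summand \<open>fact (n - 1)\<close> of
    \<open>B' n\<close>, the other from the divisor \<open>d = n\<close>.\<close>
  ultimately have "(\<lambda>n. 1 / fact (n - 1) + 1 + (real n - 2) / real n + R n) \<longlonglongrightarrow> 0 + 1 + 1 + 0"
    by (intro tendsto_add tendsto_const)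
  then have "(\<lambda>n. 1 / fact (n - 1) + 1 + (real n - 2) / real n + R n) \<longlonglongrightarrow> 2"
    by simp
  moreover have "\<forall>\<^sub>F n in sequentially. 1 / fact (n - 1) + 1 + (real n - 2) / real n + R n
                   = B' n / fact (n - 1)"
    using eventually_gt_at_top[of 0] by eventually_elim (simp only: split)
  ultimately show ?thesis
    by (rule Lim_transform_eventually)
qed

end
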